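(* Consider $m$ datasets and $n$ buyers, where each buyer $i\in[n]$ has budget $b_i\in\mathbb{R}_{\ge 0}\cup\{\infty\}$ and a linear valuation function $\tau_i:[0,1]^m\to\mathbb{R}_{\ge 0}$, $\tau_i(\mathbf{x})=\sum_{j=1}^m\tau_{i,j}x_j$ with $\tau_{i,j}\in\mathbb{R}_{\ge 0}$. Let $\mathbf{p}:[0,1]^m\to\mathbb{R}_{\ge 0}$ be a separable MLC pricing function. Then there exists a separable pricing function $\widehat{\mathbf{p}}$ such that: 1. $r(\widehat{\mathbf{p}}\mid\tau_i,b_i)\ge r(\mathbf{p}\mid\tau_i,b_i)$ for all $i\in[n]$. 2. Each component of $\widehat{\mathbf{p}}$ is monotone, continuous, convex, and piecewise-linear. 3. For each component $\widehat{p}_j$ of $\widehat{\mathbf{p}}$ and any point $x\in(0,1]$, the left derivative $\widehat{p}_j'(x)$ belongs to the set $\{\tau_{i,j}:i\in[n]\}$.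
   Context: A function $f:[0,1]^m\to\mathbb{R}$ is monotone if $x_j\le y_j$ for all $j$ implies $f(\mathbf{x})\le f(\mathbf{y})$. It is lower-continuous if $f(\hat{\mathbf{x}})=\sup_{\delta>0}\inf\{f(\mathbf{x}):\mathbf{x}\in[0,1]^m,\ \|\mathbf{x}-\hat{\mathbf{x}}\|_\infty\le\delta\}$ for all $\hat{\mathbf{x}}\in[0,1]^m$ (i.e. lower semicontinuous). MLC means monotone and lower-continuous. A pricing function is a monotone function $\mathbf{p}:[0,1]^m\to\mathbb{R}_{\ge 0}$ with $\mathbf{p}(\mathbf{0})=0$. A function $f:[0,1]^m\to\mathbb{R}$ is separable if $f(\mathbf{x})=\sum_{j=1}^m f_j(x_j)$ for some functions $f_j:[0,1]\to\mathbb{R}$, called its components (unique up to additive constants). Piecewise-linear means with finitely many linear pieces. For a pricing function $\mathbf{p}$, valuation $\tau:[0,1]^m\to\mathbb{R}_{\ge 0}$ and budget $b\in\mathbb{R}_{\ge 0}\cup\{\infty\}$: $F(\mathbf{p}\mid b)=\{\mathbf{x}\in[0,1]^m:\mathbf{p}(\mathbf{x})\le b\}$; $u^*(\mathbf{p}\mid\tau,b)=\sup_{\mathbf{x}\in F(\mathbf{p}\mid b)}(\tau(\mathbf{x})-\mathbf{p}(\mathbf{x}))$; the demand set is $\mathit{OPT}(\mathbf{p}\mid\tau,b)=\{\mathbf{x}\in F(\mathbf{p}\mid b):\tau(\mathbf{x})-\mathbf{p}(\mathbf{x})=u^*(\mathbf{p}\mid\tau,b)\}$; the revenue is $r(\mathbf{p}\mid\tau,b)=\sup_{\mathbf{x}\in\mathit{OPT}(\mathbf{p}\mid\tau,b)}\mathbf{p}(\mathbf{x})$.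 *)

theory Defs
  imports "HOL-Analysis.Analysis"
begin

text \<open>
  The unit cube \<open>[0,1]\<^sup>m\<close> is the order interval \<open>{0..1}\<close> of \<^typ>\<open>real ^ 'm\<close>: the order on vectors is
  componentwise and \<open>1\<close> is the all-ones vector. Functions on the cube (or on \<open>[0,1]\<close>) are total
  HOL functions; every definition below only inspects their values there.
\<close>

text \<open>
  The infima and the supremum are taken in \<^typ>\<open>ereal\<close>, so that a function that is unbounded below
  near \<open>y\<close> gets the infimum \<open>-\<infinity>\<close> instead of an unspecified real.
\<close>

definition lower_continuous :: "(real ^ 'm \<Rightarrow> real) \<Rightarrow> bool" where
  "lower_continuous f \<longleftrightarrow>
     (\<forall>y\<in>{0..1}. ereal (f y) =
        (SUP \<delta>\<in>{0<..}. INF x\<in>{x\<in>{0..1}. infnorm (x - y) \<le> \<delta>}. ereal (f x)))"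

definition MLC :: "(real ^ 'm \<Rightarrow> real) \<Rightarrow> bool" where
  "MLC f \<longleftrightarrow> mono_on {0..1} f \<and> lower_continuous f"

definition pricing_function :: "(real ^ 'm \<Rightarrow> real) \<Rightarrow> bool" where
  "pricing_function p \<longleftrightarrow> mono_on {0..1} p \<and> (\<forall>x\<in>{0..1}. 0 \<le> p x) \<and> p 0 = 0"

definition has_components :: "(real ^ 'm \<Rightarrow> real) \<Rightarrow> ('m \<Rightarrow> real \<Rightarrow> real) \<Rightarrow> bool" where
  "has_components f g \<longleftrightarrow> (\<forall>x\<in>{0..1}. f x = (\<Sum>j\<in>UNIV. g j (x $ j)))"

definition separable :: "(real ^ 'm \<Rightarrow> real) \<Rightarrow> bool" where
  "separable f \<longleftrightarrow> (\<exists>g. has_components f g)"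

text \<open>
  The pieces may be open, half-open, closed or degenerate intervals, and continuity is not implied.
\<close>

definition piecewise_linear_on :: "real set \<Rightarrow> (real \<Rightarrow> real) \<Rightarrow> bool" where
  "piecewise_linear_on S f \<longleftrightarrow>
     (\<exists>P. finite P \<and> \<Union>P = S \<and>
        (\<forall>I\<in>P. is_interval I \<and> (\<exists>a c. \<forall>x\<in>I. f x = a * x + c)))"

definition linear_valuation :: "('m \<Rightarrow> real) \<Rightarrow> real ^ 'm \<Rightarrow> real" where
  "linear_valuation t x = (\<Sum>j\<in>UNIV. t j * x $ j)"

definition feasible :: "(real ^ 'm \<Rightarrow> real) \<Rightarrow> ereal \<Rightarrow> (real ^ 'm) set" where
  "feasible p b = {x\<in>{0..1}. ereal (p x) \<le> b}"

text \<open>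
  For a pricing function and a nonnegative budget, \<open>0\<close> is feasible, and a linear valuation is bounded
  on the cube, so the following supremum is over a nonempty set that is bounded above.
\<close>

definition max_utility :: "(real ^ 'm \<Rightarrow> real) \<Rightarrow> (real ^ 'm \<Rightarrow> real) \<Rightarrow> ereal \<Rightarrow> real" where
  "max_utility p v b = (SUP x\<in>feasible p b. v x - p x)"

definition demand :: "(real ^ 'm \<Rightarrow> real) \<Rightarrow> (real ^ 'm \<Rightarrow> real) \<Rightarrow> ereal \<Rightarrow> (real ^ 'm) set" where
  "demand p v b = {x\<in>feasible p b. v x - p x = max_utility p v b}"

text \<open>
  A monotone price is bounded by its value at \<open>1\<close>. The demand set is nonempty if the price is
  moreover lower-continuous and the valuation continuous; for other prices it may be empty, and the
  real supremum is then unspecified.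
\<close>

definition revenue :: "(real ^ 'm \<Rightarrow> real) \<Rightarrow> (real ^ 'm \<Rightarrow> real) \<Rightarrow> ereal \<Rightarrow> real" where
  "revenue p v b = (SUP x\<in>demand p v b. p x)"

end

theory Submission
  imports Defs
begin

text \<open>
  Let \<open>U\<^sub>i\<^sub>j\<close> be the maximal utility \<open>max\<^sub>t (\<tau>\<^sub>i\<^sub>j t - p\<^sub>j t)\<close> of buyer \<open>i\<close> on dataset \<open>j\<close> without
  a budget, and replace \<open>p\<^sub>j\<close> by \<open>h\<^sub>j t = max\<^sub>i (\<tau>\<^sub>i\<^sub>j t - U\<^sub>i\<^sub>j)\<close>, shifted to vanish at \<open>0\<close>: a maximum of
  lines with slopes \<open>\<tau>\<^sub>i\<^sub>j\<close>. Then \<open>h\<^sub>j \<le> p\<^sub>j\<close> with equality wherever a buyer without budget demands, so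
  such a buyer's demand for the old price stays optimal for the new one, and the shift only
  raises its price. Budgets do no further harm: under the old price a buyer pays at most the budget,
  whereas convexity of the new price lets a buyer whose unconstrained optimum is too expensive
  move towards it, at no loss of utility, until the budget is exhausted.
\<close>

section \<open>Maxima of finitely many lines\<close>

definition line_max :: "('n::finite \<Rightarrow> real) \<Rightarrow> ('n \<Rightarrow> real) \<Rightarrow> real \<Rightarrow> real" where
  "line_max a c t = (MAX i. a i * t - c i)"

lemma le_line_max: "a i * t - c i \<le> line_max a c t"
  unfolding line_max_def by (rule Max_ge) auto

lemma line_max_le: "(\<And>i. a i * t - c i \<le> y) \<Longrightarrow> line_max a c t \<le> y"
  unfolding line_max_def by (subst Max_le_iff) auto

lemma line_max_attained: "\<exists>i. line_max a c t = a i * t - c i"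
proof -
  have "line_max a c t \<in> range (\<lambda>i. a i * t - c i)"
    unfolding line_max_def by (rule Max_in) auto
  then show ?thesis by auto
qed

lemma line_max_mono:
  assumes "\<And>i. 0 \<le> a i" "s \<le> t"
  shows "line_max a c s \<le> line_max a c t"
proof (rule line_max_le)
  fix i
  have "a i * s - c i \<le> a i * t - c i"
    using assms by (simp add: mult_left_mono)
  also have "\<dots> \<le> line_max a c t" by (rule le_line_max)
  finally show "a i * s - c i \<le> line_max a c t" .
qed

text \<open>A maximum of affine functions is convex. The domain is \<open>UNIV\<close> because
  convexity on an open set also yields continuity.\<close>

lemma convex_on_line_max: "convex_on UNIV (line_max a c)"
proof (rule convex_onI)
  fix t x y :: real
  assume t: "0 < t" "t < 1"
  show "line_max a c ((1 - t) *\<^sub>R x + t *\<^sub>R y) \<le> (1 - t) * line_max a c x + t * line_max a c y"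
  proof (rule line_max_le)
    fix i
    have "a i * ((1 - t) *\<^sub>R x + t *\<^sub>R y) - c i
        = (1 - t) * (a i * x - c i) + t * (a i * y - c i)"
      by (simp add: algebra_simps)
    also have "\<dots> \<le> (1 - t) * line_max a c x + t * line_max a c y"
      using t by (intro add_mono mult_left_mono le_line_max) auto
    finally show "a i * ((1 - t) *\<^sub>R x + t *\<^sub>R y) - c i
        \<le> (1 - t) * line_max a c x + t * line_max a c y" .
  qed
qed simp

lemma continuous_on_line_max: "continuous_on S (line_max a c)"
  using convex_on_continuous[OF open_UNIV convex_on_line_max] continuous_on_subset by blast

text \<open>Each line contributes the points where it is on top. Linear inequalities cut these sets
  out of \<open>S\<close>, so they are intervals, possibly empty or overlapping. The offset
  \<open>d\<close> accommodates the vertical shift of a component.\<close>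

lemma line_max_piecewise_linear:
  assumes "is_interval S"
  shows "piecewise_linear_on S (\<lambda>t. line_max a c t + d)"
proof -
  define I where "I i = {t \<in> S. \<forall>k. a k * t - c k \<le> a i * t - c i}" for i
  have "\<exists>i. t \<in> I i" if "t \<in> S" for t
    using that line_max_attained[of a c t] le_line_max[of a _ t c] by (auto simp: I_def) metis
  then have "\<Union> (range I) = S"
    by (auto simp: I_def)
  moreover have "is_interval (I i)" for i
  proof -
    have "I i = S \<inter> (\<Inter>k. {t. (a k - a i) * t \<le> c k - c i})"
      by (auto simp: I_def algebra_simps)
    moreover have "convex {t. (a k - a i) * t \<le> c k - c i}" for k
      using convex_halfspace_le[of "a k - a i" "c k - c i"] by simp
    ultimately show ?thesis
      using assms by (auto simp: is_interval_convex_1 intro!: convex_Int convex_INT)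
  qed
  moreover have "line_max a c t + d = a i * t + (d - c i)" if "t \<in> I i" for t i
    using that le_line_max[of a i t c] line_max_le[of a t c "a i * t - c i"]
    by (simp add: I_def)
  then have "\<exists>a' c'. \<forall>t\<in>I i. line_max a c t + d = a' * t + c'" for i
    by blast
  ultimately show ?thesis
    unfolding piecewise_linear_on_def by (intro exI[of _ "range I"]) simp
qed

text \<open>Immediately to the left of \<open>x\<close>, the flattest of the lines active at
  \<open>x\<close> is on top: the other active lines fall below it when moving left, and the
  inactive ones stay below by continuity.\<close>

lemma line_max_left_derivative:
  "\<exists>i. (line_max a c has_real_derivative a i) (at_left x)"
proof -
  define A where "A = {i. a i * x - c i = line_max a c x}"
  have "finite A" "A \<noteq> {}"
    using line_max_attained[of a c x] by (auto simp: A_def)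
  then obtain i where i: "i \<in> A" and least: "\<And>k. k \<in> A \<Longrightarrow> a i \<le> a k"
    using arg_min_if_finite(1)[of A a] arg_min_least[of A _ a] by blast
  have "\<forall>\<^sub>F y in at_left x. a k * y - c k \<le> a i * y - c i" for k
  proof (cases "k \<in> A")
    case True
    have "a k * y - c k \<le> a i * y - c i" if "y < x" for y
    proof -
      have "a i * (x - y) \<le> a k * (x - y)"
        using least[OF True] that by (intro mult_right_mono) auto
      then show ?thesis using True i by (auto simp: A_def algebra_simps)
    qed
    then show ?thesis by (auto simp: eventually_at_filter)
  next
    case False
    have "a k * x - c k < a i * x - c i"
      using False i le_line_max[of a k x c] by (auto simp: A_def)
    moreover have "((\<lambda>y. a k * y - c k) \<longlongrightarrow> a k * x - c k) (at_left x)"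
      "((\<lambda>y. a i * y - c i) \<longlongrightarrow> a i * x - c i) (at_left x)"
      by (auto intro!: tendsto_intros)
    ultimately have "\<forall>\<^sub>F y in at_left x. 0 < (a i * y - c i) - (a k * y - c k)"
      by (intro order_tendstoD(1)[OF tendsto_diff]) auto
    then show ?thesis by (rule eventually_mono) simp
  qed
  then have "\<forall>\<^sub>F y in at_left x. \<forall>k. a k * y - c k \<le> a i * y - c i"
    by (simp add: eventually_all_finite)
  then have "\<forall>\<^sub>F y in at_left x. line_max a c y = a i * y - c i"
    by (rule eventually_mono) (meson le_line_max line_max_le order_antisym)
  moreover have "line_max a c x = a i * x - c i"
    using i by (simp add: A_def)
  moreover have "((\<lambda>y. a i * y - c i) has_real_derivative a i) (at_left x)"
    by (auto intro!: derivative_eq_intros)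
  ultimately have "(line_max a c has_real_derivative a i) (at_left x)"
    by (subst has_field_derivative_cong_eventually)
  then show ?thesis ..
qed

section \<open>Components of separable functions\<close>

lemma zero_in_cube: "0 \<in> {0..1::real ^ 'm}"
  by (simp add: less_eq_vec_def)

lemma axis_in_cube: "t \<in> {0..1} \<Longrightarrow> axis j t \<in> {0..1::real ^ 'm}"
  by (auto simp: less_eq_vec_def axis_def)

lemma has_components_axis:
  fixes f :: "real ^ 'm::finite \<Rightarrow> real"
  assumes "has_components f g" "t \<in> {0..1}"
  shows "f (axis j t) = g j t + (\<Sum>k\<in>UNIV - {j}. g k 0)"
proof -
  have "f (axis j t) = (\<Sum>k\<in>UNIV. g k (axis j t $ k))"
    using assms axis_in_cube[of t j] by (simp add: has_components_def)
  also have "\<dots> = g j t + (\<Sum>k\<in>UNIV - {j}. g k (axis j t $ k))"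
    by (subst sum.remove[of _ j]) (auto simp: axis_def)
  also have "(\<Sum>k\<in>UNIV - {j}. g k (axis j t $ k)) = (\<Sum>k\<in>UNIV - {j}. g k 0)"
    by (rule sum.cong) (auto simp: axis_def)
  finally show ?thesis .
qed

text \<open>On a coordinate axis all other components are frozen at 0, so only a constant is
  undetermined. This transfers properties from one choice of components to every choice.\<close>

lemma has_components_unique:
  fixes f :: "real ^ 'm::finite \<Rightarrow> real"
  assumes "has_components f g" "has_components f q"
  obtains d where "\<And>t. t \<in> {0..1} \<Longrightarrow> q j t = g j t + d"
proof
  fix t :: real
  assume "t \<in> {0..1}"
  then show "q j t = g j t + ((\<Sum>k\<in>UNIV - {j}. g k 0) - (\<Sum>k\<in>UNIV - {j}. q k 0))"
    using has_components_axis[OF assms(1), of t j] has_components_axis[OF assms(2), of t j] by simp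
qed

text \<open>The cube is a product, so coordinate \<open>j\<close> of \<open>x\<close> can be changed
  alone; the terms of the other coordinates cancel. A budget would couple the coordinates, hence the
  maximum is over the whole cube.\<close>

lemma separable_max_component:
  fixes p :: "real ^ 'm::finite \<Rightarrow> real"
  assumes g: "has_components p g" and x: "x \<in> {0..1}"
    and max: "\<And>y. y \<in> {0..1} \<Longrightarrow> linear_valuation a y - p y \<le> linear_valuation a x - p x"
    and t: "t \<in> {0..1}"
  shows "a j * t - g j t \<le> a j * (x $ j) - g j (x $ j)"
proof -
  define y where "y = (\<chi> k. if k = j then t else x $ k)"
  have y: "y \<in> {0..1}"
    using x t by (auto simp: y_def less_eq_vec_def)
  have split: "linear_valuation a z - p z
      = (a j * z $ j - g j (z $ j)) + (\<Sum>k\<in>UNIV - {j}. a k * z $ k - g k (z $ k))"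
    if "z \<in> {0..1}" for z
    using g that sum.remove[of UNIV j "\<lambda>k. a k * z $ k - g k (z $ k)"]
    by (simp add: has_components_def linear_valuation_def sum_subtractf)
  have "(\<Sum>k\<in>UNIV - {j}. a k * y $ k - g k (y $ k))
      = (\<Sum>k\<in>UNIV - {j}. a k * x $ k - g k (x $ k))"
    by (rule sum.cong) (auto simp: y_def)
  then show ?thesis
    using max[OF y] split[OF x] split[OF y] by (simp add: y_def)
qed

section \<open>Attainment of the demand\<close>

lemma lower_continuousD:
  fixes f :: "real ^ 'm::finite \<Rightarrow> real"
  assumes "lower_continuous f" "y \<in> {0..1}" "a < f y"
  obtains \<delta> where "\<delta> > 0" "\<And>x. x \<in> {0..1} \<Longrightarrow> infnorm (x - y) \<le> \<delta> \<Longrightarrow> a < f x"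
proof -
  have "ereal a < (SUP \<delta>\<in>{0<..}. INF x\<in>{x\<in>{0..1}. infnorm (x - y) \<le> \<delta>}. ereal (f x))"
    using assms(1,2) \<open>a < f y\<close> unfolding lower_continuous_def
    by (metis (no_types, lifting) less_ereal.simps(1))
  then obtain \<delta> where "\<delta> > 0"
    and less: "ereal a < (INF x\<in>{x\<in>{0..1}. infnorm (x - y) \<le> \<delta>}. ereal (f x))"
    by (auto simp: less_SUP_iff)
  have "a < f x" if "x \<in> {0..1}" "infnorm (x - y) \<le> \<delta>" for x
    using less_le_trans[OF less INF_lower[of x]] that by simp
  then show ?thesis using \<open>\<delta> > 0\<close> that by blast
qed

lemma convex_cube: "convex {0..1::real ^ 'm::finite}"
  by (simp add: interval_cbox_cart)

lemma closed_cube: "closed {0..1::real ^ 'm::finite}"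
  by (simp add: interval_cbox_cart closed_cbox)

text \<open>With \<open>v\<close> the valuation this concerns the negated utility; with
  \<open>v\<close> zero it yields closed budget sets.\<close>

lemma closed_sublevel:
  fixes f :: "real ^ 'm::finite \<Rightarrow> real"
  assumes f: "lower_continuous f" and v: "continuous_on {0..1} v"
  shows "closed {x \<in> {0..1}. f x - v x \<le> c}"
  unfolding closed_sequential_limits
proof (intro allI impI, elim conjE)
  fix X l
  assume X: "\<forall>n. X n \<in> {x \<in> {0..1}. f x - v x \<le> c}" and lim: "X \<longlonglongrightarrow> l"
  have l: "l \<in> {0..1}"
    using closed_sequentially[OF closed_cube _ lim] X by blast
  have "f l \<le> c + v l"
  proof (rule ccontr)
    assume "\<not> f l \<le> c + v l"
    \<comment> \<open>The level \<open>a\<close> splits the gap: along the sequence \<open>f\<close>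
      eventually stays above \<open>a\<close>, by lower continuity, while \<open>c + v\<close> falls
      below \<open>a\<close>.\<close>
    then obtain a where a: "c + v l < a" "a < f l"
      using dense[of "c + v l" "f l"] by auto
    obtain \<delta> where \<delta>: "\<delta> > 0" "\<And>x. x \<in> {0..1} \<Longrightarrow> infnorm (x - l) \<le> \<delta> \<Longrightarrow> a < f x"
      using lower_continuousD[OF f l a(2)] by blast
    have "(\<lambda>n. v (X n)) \<longlonglongrightarrow> v l"
      using v lim l X by (auto simp: continuous_on_sequentially comp_def)
    then have "\<forall>\<^sub>F n in sequentially. v (X n) < a - c"
      using a by (intro order_tendstoD) auto
    moreover have "\<forall>\<^sub>F n in sequentially. dist (X n) l < \<delta>"
      using lim \<delta>(1) by (rule tendstoD)
    ultimately obtain n where n: "v (X n) < a - c" "dist (X n) l < \<delta>"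
      using eventually_happens'[OF sequentially_bot eventually_conj] by blast
    have "a < f (X n)"
      using X n(2) infnorm_le_norm[of "X n - l"] by (intro \<delta>(2)) (auto simp: dist_norm)
    moreover have "f (X n) \<le> c + v (X n)"
      using X by (simp add: algebra_simps)
    ultimately show False using n(1) by simp
  qed
  then show "l \<in> {x \<in> {0..1}. f x - v x \<le> c}"
    using l by (simp add: algebra_simps)
qed

text \<open>Weierstrass for lower semicontinuous functions. A point in all sublevel sets at levels
  \<open>f z\<close> is a minimizer; for finitely many \<open>z\<close> the one with least value
  lies in all of them, and compactness does the rest.\<close>

lemma compact_attains_min:
  fixes f :: "'a::metric_space \<Rightarrow> real"
  assumes "compact S" "S \<noteq> {}" and closed: "\<And>c. closed {x \<in> S. f x \<le> c}"
  obtains x where "x \<in> S" "\<And>y. y \<in> S \<Longrightarrow> f x \<le> f y"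
proof -
  have "S \<inter> (\<Inter>z\<in>S. {x \<in> S. f x \<le> f z}) \<noteq> {}"
  proof (rule compact_imp_fip_image[OF \<open>compact S\<close> closed])
    fix F
    assume F: "finite F" "F \<subseteq> S"
    show "S \<inter> (\<Inter>z\<in>F. {x \<in> S. f x \<le> f z}) \<noteq> {}"
    proof (cases "F = {}")
      case False
      then obtain x where "x \<in> F" "\<And>z. z \<in> F \<Longrightarrow> f x \<le> f z"
        using F(1) arg_min_if_finite(1)[of F f] arg_min_least[of F _ f] by blast
      then show ?thesis using F(2) by blast
    qed (use assms in simp)
  qed
  then show ?thesis using that by blast
qed

text \<open>Phrased by closed sublevel sets so as to serve both the lower-continuous old price and
  the continuous new one.\<close>

lemma feasible_attains_max:
  fixes p :: "real ^ 'm::finite \<Rightarrow> real"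
  assumes p: "\<And>c. closed {x \<in> {0..1}. p x \<le> c}" "\<And>c. closed {x \<in> {0..1}. p x - v x \<le> c}"
    and "p 0 = 0" "0 \<le> b"
  obtains x where "x \<in> feasible p b" "\<And>y. y \<in> feasible p b \<Longrightarrow> v y - p y \<le> v x - p x"
proof -
  have cl: "closed (feasible p b)"
  proof (cases b)
    case (real r)
    then show ?thesis using p(1)[of r] by (simp add: feasible_def)
  next
    case PInf
    then have "feasible p b = {0..1}" by (auto simp: feasible_def)
    then show ?thesis using closed_cube by simp
  qed (use assms in auto)
  have "compact ({0..1::real ^ 'm})"
    by (simp add: interval_cbox_cart)
  then have "compact ({0..1} \<inter> feasible p b)"
    using cl by (rule compact_Int_closed)
  then have cpt: "compact (feasible p b)"
    by (simp add: Int_absorb1 subset_eq feasible_def)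
  have "0 \<in> feasible p b"
    using assms zero_in_cube by (simp add: feasible_def flip: zero_ereal_def)
  then have ne: "feasible p b \<noteq> {}" by blast
  have "closed {x \<in> feasible p b. p x - v x \<le> c}" for c
  proof -
    have "{x \<in> feasible p b. p x - v x \<le> c} = feasible p b \<inter> {x \<in> {0..1}. p x - v x \<le> c}"
      by (auto simp: feasible_def)
    then show ?thesis using cl p(2)[of c] by auto
  qed
  from compact_attains_min[OF cpt ne this] obtain x
    where "x \<in> feasible p b" "\<And>y. y \<in> feasible p b \<Longrightarrow> p x - v x \<le> p y - v y"
    by metis
  then show ?thesis by (intro that) force+
qed

lemma demandI:
  assumes "x \<in> feasible p b" "\<And>y. y \<in> feasible p b \<Longrightarrow> v y - p y \<le> v x - p x"
  shows "x \<in> demand p v b"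
proof -
  have "max_utility p v b = v x - p x"
    unfolding max_utility_def using assms by (intro cSup_eq_maximum) auto
  then show ?thesis using assms(1) by (simp add: demand_def)
qed

text \<open>The hypothesis \<open>x0\<close> ensures that the supremum defining \<^const>\<open>max_utility\<close> is a maximum.\<close>

lemma demandD:
  assumes x0: "x0 \<in> feasible p b" "\<And>y. y \<in> feasible p b \<Longrightarrow> v y - p y \<le> v x0 - p x0"
    and x: "x \<in> demand p v b" and y: "y \<in> feasible p b"
  shows "v y - p y \<le> v x - p x"
proof -
  have "x0 \<in> demand p v b" using demandI[OF x0] .
  then show ?thesis using x0(2)[OF y] x by (simp add: demand_def)
qed

text \<open>The price of the all-ones vector bounds the prices of demanded bundles, so the real
  supremum is a genuine one.\<close>

lemma revenue_upper:
  fixes p :: "real ^ 'm::finite \<Rightarrow> real"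
  assumes "mono_on {0..1} p" "x \<in> demand p v b"
  shows "p x \<le> revenue p v b"
proof -
  have "p y \<le> p 1" if "y \<in> demand p v b" for y
    using that by (intro mono_onD[OF assms(1)])
      (auto simp: demand_def feasible_def less_eq_vec_def)
  then have "bdd_above (p ` demand p v b)"
    by (intro bdd_aboveI2)
  then show ?thesis
    unfolding revenue_def by (rule cSUP_upper[OF assms(2)])
qed

section \<open>Budgets under convex prices\<close>

lemma linear_linear_valuation: "linear (linear_valuation a)"
  by (rule linearI)
    (simp_all add: linear_valuation_def sum.distrib sum_distrib_left algebra_simps)

lemma continuous_on_linear_valuation: "continuous_on S (linear_valuation a)"
  by (simp add: linear_continuous_on linear_conv_bounded_linear[symmetric] linear_linear_valuation)

text \<open>An affordable \<open>x\<close> is itself demanded. Otherwise move from a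
  budget-constrained optimum \<open>y\<close> towards \<open>x\<close>: utility is concave and no
  smaller at \<open>x\<close>, so it never drops below its value at \<open>y\<close>, and by
  continuity some point of the segment costs exactly the budget.\<close>

lemma convex_price_demand:
  fixes p :: "real ^ 'm::finite \<Rightarrow> real"
  assumes p: "convex_on {0..1} p" "continuous_on {0..1} p" "p 0 = 0" and b: "0 \<le> b"
    and x: "x \<in> {0..1}"
    and max: "\<And>y. y \<in> {0..1} \<Longrightarrow> linear_valuation a y - p y \<le> linear_valuation a x - p x"
  obtains z where "z \<in> demand p (linear_valuation a) b" "min b (ereal (p x)) \<le> ereal (p z)"
proof (cases "ereal (p x) \<le> b")
  case True
  then have "x \<in> demand p (linear_valuation a) b"
    using x max by (intro demandI) (auto simp: feasible_def)
  then show ?thesis using that by (simp add: min.coboundedI2)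
next
  case False
  let ?v = "linear_valuation a"
  obtain r where r: "b = ereal r" "r < p x"
    using False b by (cases b) auto
  have sub: "closed {x \<in> {0..1}. p x - w x \<le> c}" if "continuous_on {0..1} w" for w c
    using continuous_closed_preimage[OF continuous_on_diff[OF p(2) that] closed_cube, of "{..c}"]
    by (simp add: vimage_def Int_def)
  have "closed {x \<in> {0..1}. p x \<le> c}" for c
    using sub[of "\<lambda>_. 0"] by simp
  then obtain y where y: "y \<in> feasible p b" "\<And>z. z \<in> feasible p b \<Longrightarrow> ?v z - p z \<le> ?v y - p y"
    using feasible_attains_max[OF _ sub[OF continuous_on_linear_valuation] p(3) b]
    by blast
  define s where "s t = (1 - t) *\<^sub>R y + t *\<^sub>R x" for t :: real
  have cube: "s t \<in> {0..1}" if "t \<in> {0..1}" for t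
    using that x y(1) convex_cube
    unfolding s_def by (intro convexD) (auto simp: feasible_def)
  have "continuous_on {0..1} (\<lambda>t. p (s t))"
    using cube by (intro continuous_on_compose2[OF p(2)])
      (auto simp: s_def intro!: continuous_intros)
  then have "\<exists>t\<ge>0. t \<le> 1 \<and> p (s t) = r"
    using y(1) r by (intro IVT') (auto simp: s_def feasible_def)
  then obtain t where t: "t \<in> {0..1}" "p (s t) = r" by auto
  have "p (s t) \<le> (1 - t) * p y + t * p x"
    using convex_onD[OF p(1), of t y x] t(1) x y(1) by (auto simp: s_def feasible_def)
  moreover have "?v (s t) = (1 - t) * ?v y + t * ?v x"
    by (simp add: s_def linear_add[OF linear_linear_valuation]
        linear_scale[OF linear_linear_valuation])
  moreover have "t * (?v y - p y) \<le> t * (?v x - p x)"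
    using max[of y] y(1) t(1) by (intro mult_left_mono) (auto simp: feasible_def)
  ultimately have "?v y - p y \<le> ?v (s t) - p (s t)"
    by (simp add: algebra_simps)
  then have "s t \<in> demand p ?v b"
    using t r cube y(2) by (intro demandI) (force simp: feasible_def)+
  then show ?thesis using that t r by simp
qed

section \<open>The new price and its revenue\<close>

theorem theorem1:
  fixes \<tau> :: "'n::finite \<Rightarrow> 'm::finite \<Rightarrow> real"
    and b :: "'n \<Rightarrow> ereal"
    and p :: "real ^ 'm \<Rightarrow> real"
  assumes "\<And>i. 0 \<le> b i"
    and "\<And>i j. 0 \<le> \<tau> i j"
    and "pricing_function p"
    and "separable p"
    and "MLC p"
  shows "\<exists>p'. pricing_function p' \<and> separable p' \<and>
    (\<forall>i. revenue p' (linear_valuation (\<tau> i)) (b i) \<ge> revenue p (linear_valuation (\<tau> i)) (b i)) \<and>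
    (\<forall>q. has_components p' q \<longrightarrow>
      (\<forall>j. mono_on {0..1} (q j) \<and> continuous_on {0..1} (q j) \<and> convex_on {0..1} (q j) \<and>
           piecewise_linear_on {0..1} (q j)) \<and>
      (\<forall>j. \<forall>x\<in>{0<..1}. \<exists>d\<in>{\<tau> i j | i. True}. (q j has_real_derivative d) (at_left x)))"
proof -
  let ?v = "\<lambda>i. linear_valuation (\<tau> i)"
  obtain g where g: "has_components p g"
    using assms(4) by (auto simp: separable_def)
  have p0: "p 0 = 0" and lc: "lower_continuous p"
    using assms(3,5) by (auto simp: pricing_function_def MLC_def)
  \<comment> \<open>Used with \<open>c\<close> infinite for unconstrained optima and with
    \<open>c\<close> the actual budget.\<close>
  have attained: "\<exists>x\<in>feasible p c. \<forall>y\<in>feasible p c. ?v i y - p y \<le> ?v i x - p x"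
    if c: "0 \<le> c" for i c
  proof -
    have "closed {x \<in> {0..1}. p x \<le> d}" for d
      using closed_sublevel[OF lc, of "\<lambda>_. 0"] by simp
    then obtain x where "x \<in> feasible p c"
      "\<And>y. y \<in> feasible p c \<Longrightarrow> ?v i y - p y \<le> ?v i x - p x"
      using feasible_attains_max[OF _ closed_sublevel[OF lc continuous_on_linear_valuation] p0 c]
      by blast
    then show ?thesis by blast
  qed
  define best where
    "best i x \<longleftrightarrow> x \<in> {0..1} \<and> (\<forall>y\<in>{0..1}. ?v i y - p y \<le> ?v i x - p x)" for i x
  have "\<exists>x. best i x" for i
    using attained[of \<infinity> i] by (auto simp: best_def feasible_def)
  then obtain X where X: "\<And>i. best i (X i)" by metis
  \<comment> \<open>By separability, the coordinates of one unconstrained optimum attain the maximal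
    utility on every dataset at once.\<close>
  define U where "U i j = \<tau> i j * (X i $ j) - g j (X i $ j)" for i j
  have U_ge: "\<tau> i j * t - g j t \<le> U i j" if "t \<in> {0..1}" for i j t
    unfolding U_def using X[of i] that
    by (intro separable_max_component[OF g, where a = "\<tau> i"]) (auto simp: best_def)
  \<comment> \<open>Every unconstrained optimum is covered, not only \<open>X i\<close>, since a
    buyer may demand a different one under \<open>p\<close>.\<close>
  have U_eq: "\<tau> i j * (x $ j) - g j (x $ j) = U i j" if x: "best i x" for i j x
  proof (rule antisym)
    show "\<tau> i j * (x $ j) - g j (x $ j) \<le> U i j"
      using x by (intro U_ge) (auto simp: best_def less_eq_vec_def)
    show "U i j \<le> \<tau> i j * (x $ j) - g j (x $ j)"
      unfolding U_def using x X[of i]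
      by (intro separable_max_component[OF g, where a = "\<tau> i"])
        (auto simp: best_def less_eq_vec_def)
  qed
  define h where "h j = line_max (\<lambda>i. \<tau> i j) (\<lambda>i. U i j)" for j
  define p' where "p' x = (\<Sum>j\<in>UNIV. h j (x $ j) - h j 0)" for x :: "real ^ 'm"
  have comps: "has_components p' (\<lambda>j t. h j t - h j 0)"
    by (simp add: has_components_def p'_def)
  have h_mono: "h j s \<le> h j t" if "s \<le> t" for j s t
    unfolding h_def using assms(2) that by (rule line_max_mono)
  have mono: "mono_on {0..1} p'"
    by (auto intro!: mono_onI sum_mono h_mono simp: p'_def less_eq_vec_def)
  have p'0: "p' 0 = 0"
    by (simp add: p'_def)
  have pricing: "pricing_function p'"
    using mono p'0 by (auto simp: pricing_function_def p'_def less_eq_vec_def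
        intro!: sum_nonneg h_mono)
  have conv: "convex_on {0..1} p'"
    unfolding p'_def
  proof (rule convex_onI)
    fix t :: real and x y :: "real ^ 'm"
    assume t: "0 < t" "t < 1"
    have "h j (((1 - t) *\<^sub>R x + t *\<^sub>R y) $ j) - h j 0
        \<le> (1 - t) * (h j (x $ j) - h j 0) + t * (h j (y $ j) - h j 0)" for j
      using convex_onD[OF convex_on_line_max, of t "x $ j" "y $ j"] t
      by (simp add: h_def algebra_simps)
    then show "(\<Sum>j\<in>UNIV. h j (((1 - t) *\<^sub>R x + t *\<^sub>R y) $ j) - h j 0)
        \<le> (1 - t) * (\<Sum>j\<in>UNIV. h j (x $ j) - h j 0) + t * (\<Sum>j\<in>UNIV. h j (y $ j) - h j 0)"
      by (simp only: sum_distrib_left sum.distrib[symmetric] sum_mono)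
  qed (rule convex_cube)
  have cont: "continuous_on {0..1} p'"
    unfolding p'_def h_def
    by (intro continuous_intros continuous_on_compose2[OF continuous_on_line_max[of UNIV]]) auto
  have h_le_g: "h j t \<le> g j t" if "t \<in> {0..1}" for j t
    unfolding h_def using U_ge[OF that, of _ j] by (intro line_max_le) (simp add: algebra_simps)
  \<comment> \<open>At such a point the line of buyer \<open>i\<close> touches \<open>g j\<close>
    from below, and \<open>h j\<close> lies between the two.\<close>
  have h_eq: "h j (x $ j) = g j (x $ j)" if "best i x" for i j x
    using h_le_g[of "x $ j" j] U_eq[OF that, of j] that
      le_line_max[of "\<lambda>i. \<tau> i j" i "x $ j" "\<lambda>i. U i j"]
    by (force simp: h_def best_def less_eq_vec_def)
  have p_le: "p x \<le> p' x" if x: "best i x" for i x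
  proof -
    \<comment> \<open>The components \<open>g j\<close> need not vanish at 0, only their sum does.
      Subtracting it allows a comparison term by term: equal values at \<open>x\<close>, while
      \<open>h j 0\<close> is at most \<open>g j 0\<close>.\<close>
    have "p x = p x - p 0" using p0 by simp
    also have "\<dots> = (\<Sum>j\<in>UNIV. g j (x $ j) - g j (0 $ j))"
      unfolding sum_subtractf using g x zero_in_cube by (metis has_components_def best_def)
    also have "\<dots> \<le> p' x"
      unfolding p'_def using h_le_g[of 0] h_eq[OF x] by (intro sum_mono) auto
    finally show ?thesis .
  qed
  \<comment> \<open>The line of buyer \<open>i\<close> bounds \<open>h j\<close> from below
    everywhere and meets it at \<open>x $ j\<close>, so optimality survives coordinate by
    coordinate.\<close>
  have best': "?v i y - p' y \<le> ?v i x - p' x" if x: "best i x" for i x y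
  proof -
    have "\<tau> i j * (y $ j) - (h j (y $ j) - h j 0) \<le> \<tau> i j * (x $ j) - (h j (x $ j) - h j 0)" for j
      using le_line_max[of "\<lambda>i. \<tau> i j" i "y $ j" "\<lambda>i. U i j"] U_eq[OF x, of j] h_eq[OF x, of j]
      by (simp add: h_def)
    then show ?thesis
      unfolding linear_valuation_def p'_def sum_subtractf[symmetric] by (intro sum_mono)
  qed
  have ge: "min (b i) (ereal (p x)) \<le> ereal (revenue p' (?v i) (b i))" if x: "best i x" for i x
  proof -
    obtain z where z: "z \<in> demand p' (?v i) (b i)" "min (b i) (ereal (p' x)) \<le> ereal (p' z)"
      using convex_price_demand[OF conv cont p'0 assms(1)] x best'[OF x]
      by (metis best_def)
    have "min (b i) (ereal (p x)) \<le> min (b i) (ereal (p' x))"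
      using p_le[OF x] by (intro min.mono) auto
    also have "\<dots> \<le> ereal (p' z)" by (rule z(2))
    also have "\<dots> \<le> ereal (revenue p' (?v i) (b i))"
      using revenue_upper[OF mono z(1)] by simp
    finally show ?thesis .
  qed
  have rev: "revenue p (?v i) (b i) \<le> revenue p' (?v i) (b i)" for i
  proof -
    obtain x0 where x0: "x0 \<in> feasible p (b i)"
      "\<And>y. y \<in> feasible p (b i) \<Longrightarrow> ?v i y - p y \<le> ?v i x0 - p x0"
      using attained[OF assms(1)] by metis
    have "p x \<le> revenue p' (?v i) (b i)" if x: "x \<in> demand p (?v i) (b i)" for x
    proof -
      have x_cube: "x \<in> {0..1}" and x_b: "ereal (p x) \<le> b i"
        using x by (auto simp: demand_def feasible_def)
      \<comment> \<open>If \<open>X i\<close> is affordable, the budget costs no utility and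
        \<open>x\<close> is itself an unconstrained optimum. If not, \<open>X i\<close> costs more
        than the budget, hence more than \<open>x\<close>.\<close>
      have "\<exists>y. best i y \<and> ereal (p x) \<le> min (b i) (ereal (p y))"
      proof (cases "ereal (p (X i)) \<le> b i")
        case True
        then have "X i \<in> feasible p (b i)"
          using X[of i] by (simp add: feasible_def best_def)
        then have "?v i (X i) - p (X i) \<le> ?v i x - p x"
          using demandD[of x0 p "b i" "?v i", OF x0 x] by blast
        then have "best i x"
          using X[of i] x_cube by (force simp: best_def)
        then show ?thesis using x_b by auto
      next
        case False
        then show ?thesis using X[of i] x_b by (intro exI[of _ "X i"]) auto
      qed
      then show ?thesis using ge[of i] order_trans ereal_less_eq(3) by blast
    qed
    \<comment> \<open>Without a demanded bundle the real supremum on the left would be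
      unspecified.\<close>
    moreover have "demand p (?v i) (b i) \<noteq> {}"
      using demandI[OF x0] by blast
    ultimately show ?thesis
      unfolding revenue_def[of p] by (intro cSUP_least)
  qed
  have "(mono_on {0..1} (q j) \<and> continuous_on {0..1} (q j) \<and> convex_on {0..1} (q j) \<and>
      piecewise_linear_on {0..1} (q j)) \<and>
      (\<forall>x\<in>{0<..1}. \<exists>d\<in>{\<tau> i j | i. True}. (q j has_real_derivative d) (at_left x))"
    if q: "has_components p' q" for q j
  proof -
    \<comment> \<open>An arbitrary component \<open>q j\<close> is the shifted \<open>h j\<close>
      plus a constant, but only on the unit interval; each property is therefore proved for
      \<open>h j\<close> first and then transferred.\<close>
    obtain e where "\<And>t. t \<in> {0..1} \<Longrightarrow> q j t = h j t - h j 0 + e"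
      using has_components_unique[OF comps q, of j] by blast
    then have d: "q j t = h j t + (e - h j 0)" if "t \<in> {0..1}" for t
      using that by simp
    have "mono_on {0..1} (q j)"
      using h_mono by (auto intro!: mono_onI simp: d)
    moreover have "continuous_on {0..1} (q j)"
    proof -
      have "continuous_on {0..1} (\<lambda>t. h j t + (e - h j 0))"
        unfolding h_def by (intro continuous_intros continuous_on_line_max)
      then show ?thesis by (rule continuous_on_eq) (simp add: d)
    qed
    moreover have "convex_on {0..1} (q j)"
    proof (rule convex_onI)
      fix t x y :: real
      assume t: "0 < t" "t < 1" and xy: "x \<in> {0..1}" "y \<in> {0..1}"
      have "(1 - t) *\<^sub>R x + t *\<^sub>R y \<in> {0..1}"
        using t xy by (intro convexD) auto
      moreover have "h j ((1 - t) *\<^sub>R x + t *\<^sub>R y) \<le> (1 - t) * h j x + t * h j y"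
        using convex_onD[OF convex_on_line_max, of t x y] t by (simp add: h_def)
      ultimately show "q j ((1 - t) *\<^sub>R x + t *\<^sub>R y) \<le> (1 - t) * q j x + t * q j y"
        using xy by (simp add: d algebra_simps)
    qed simp
    moreover have "piecewise_linear_on {0..1} (q j)"
    proof -
      have "piecewise_linear_on {0..1} (\<lambda>t. h j t + (e - h j 0))"
        unfolding h_def by (rule line_max_piecewise_linear) (simp add: is_interval_cc)
      then obtain P where P: "finite P" "\<Union>P = {0..1}"
        and lin: "\<forall>I\<in>P. is_interval I \<and> (\<exists>a c. \<forall>x\<in>I. h j x + (e - h j 0) = a * x + c)"
        unfolding piecewise_linear_on_def by blast
      have "q j t = h j t + (e - h j 0)" if "t \<in> I" "I \<in> P" for t I
        using d P(2) that by blast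
      then show ?thesis
        using P lin unfolding piecewise_linear_on_def by (intro exI[of _ P]) simp
    qed
    moreover have "\<exists>d\<in>{\<tau> i j | i. True}. (q j has_real_derivative d) (at_left x)"
      if x: "x \<in> {0<..1}" for x
    proof -
      obtain i where "(h j has_real_derivative \<tau> i j) (at_left x)"
        using line_max_left_derivative[of "\<lambda>i. \<tau> i j" "\<lambda>i. U i j" x] by (auto simp: h_def)
      then have "((\<lambda>t. h j t + (e - h j 0)) has_real_derivative \<tau> i j) (at_left x)"
        by (auto intro!: derivative_eq_intros)
      \<comment> \<open>Left-neighbourhoods can be taken inside the unit interval, where
        \<open>q j\<close> is known.\<close>
      moreover have "\<forall>\<^sub>F t in at_left x. t \<in> {0<..<x}"
        using x by (intro eventually_at_leftI[of 0]) auto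
      then have "\<forall>\<^sub>F t in at_left x. h j t + (e - h j 0) = q j t"
        by (rule eventually_mono) (use x in \<open>auto simp: d\<close>)
      moreover have "h j x + (e - h j 0) = q j x"
        using x by (simp add: d)
      ultimately have "(q j has_real_derivative \<tau> i j) (at_left x)"
        by (subst (asm) has_field_derivative_cong_eventually)
      then show ?thesis by blast
    qed
    ultimately show ?thesis by blast
  qed
  then show ?thesis
    using pricing comps rev by (intro exI[of _ p']) (auto simp: separable_def)
qed

end
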